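(* Let $\alpha\in(0,1)$ and let $E,B,\rho,J$ have coefficients in $\mathscr{P}_\alpha(U_{\mathrm{st}})$, with associated Faraday $2$-form $F$ and current $3$-form $\mathcal{J}$. If $(F,\mathcal{J})$ satisfies the Lorentzian coframe-attached fractional Maxwell system $d^\alpha F=0$, $d^\alpha(\star_\alpha F)=\mathcal{J}$, then $$\square_\alpha B=\operatorname{curl}_\alpha J\qquad\text{and}\qquad \square_\alpha E=-\mathsf{D}_t^\alpha J-\nabla_\alpha\rho.$$ In particular, in the source-free case $\rho=0$ and $J=0$, both $E$ and $B$ satisfy $\square_\alpha E=0$ and $\square_\alpha B=0$.
   Context: Let $U_{\mathrm{st}}=[0,T]\times[0,b_1]\times[0,b_2]\times[0,b_3]$ ($T,b_i>0$) with coordinates $(t,x_1,x_2,x_3)$, $\Theta^\alpha=t^\alpha/\Gamma(1+\alpha)$, $X_i^\alpha=x_i^\alpha/\Gamma(1+\alpha)$, and $\mathscr{P}_\alpha(U_{\mathrm{st}})=\mathbb{R}[\Theta^\alpha,X_1^\alpha,X_2^\alpha,X_3^\alpha]$ (these four functions are algebraically independent). Write $Z_0=\Theta^\alpha$, $Z_i=X_i^\alpha$. The polynomial Caputo operators $\mathsf{D}_\mu^\alpha$, $\mu=0,1,2,3$ (with $\mathsf{D}_t^\alpha:=\mathsf{D}_0^\alpha$), are the $\mathbb{R}$-linear maps on $\mathscr{P}_\alpha(U_{\mathrm{st}})$ with $$\mathsf{D}_\mu^\alpha\prod_\nu Z_\nu^{m_\nu}=\frac{\Gamma(m_\mu\alpha+1)}{\Gamma((m_\mu-1)\alpha+1)\Gamma(1+\alpha)}Z_\mu^{m_\mu-1}\prod_{\nu\ne\mu}Z_\nu^{m_\nu}$$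 if $m_\mu\ge1$, and $0$ if $m_\mu=0$. Let $e^0=d^\alpha\Theta$, $e^i=d^\alpha X_i$ ($i=1,2,3$) be formal anticommuting degree-one generators ($e^\mu\wedge e^\nu=-e^\nu\wedge e^\mu$, $e^\mu\wedge e^\mu=0$), $e^{\mu\nu}=e^\mu\wedge e^\nu$, $e^{\mu\nu\lambda}=e^\mu\wedge e^\nu\wedge e^\lambda$; forms are elements of the exterior algebra $\Omega_\alpha^\bullet(U_{\mathrm{st}};\mathscr{P}_\alpha)$ on these generators over $\mathscr{P}_\alpha(U_{\mathrm{st}})$, and $d^\alpha(\sum_I a_Ie^I)=\sum_I\sum_{\mu=0}^3(\mathsf{D}_\mu^\alpha a_I)\,e^\mu\wedge e^I$. For a scalar $f$ and spatial field $V=(V_1,V_2,V_3)$ with coefficients in $\mathscr{P}_\alpha(U_{\mathrm{st}})$: $\nabla_\alpha f=(\mathsf{D}_1^\alpha f,\mathsf{D}_2^\alpha f,\mathsf{D}_3^\alpha f)$; $\operatorname{curl}_\alpha V=(\mathsf{D}_2^\alpha V_3-\mathsf{D}_3^\alpha V_2,\ \mathsf{D}_3^\alpha V_1-\mathsf{D}_1^\alpha V_3,\ \mathsf{D}_1^\alpha V_2-\mathsf{D}_2^\alpha V_1)$; $\Delta_\alpha V$ has components $\sum_{j=1}^3\mathsf{D}_j^\alpha\mathsf{D}_j^\alpha V_k$; $\square_\alpha=\mathsf{D}_t^\alpha\mathsf{D}_t^\alpha-\Delta_\alpha$ (with $\mathsf{D}_t^\alpha$ acting componentwise on fields). For $E=(E_1,E_2,E_3)$,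 $B=(B_1,B_2,B_3)$, $\rho$, $J=(J_1,J_2,J_3)$ with coefficients in $\mathscr{P}_\alpha(U_{\mathrm{st}})$ define $$F=-E_1e^{01}-E_2e^{02}-E_3e^{03}+B_1e^{23}-B_2e^{13}+B_3e^{12},$$ $$\mathcal{J}=\rho\,e^{123}-J_1e^{023}+J_2e^{013}-J_3e^{012}.$$ The Hodge-type operator $\star_\alpha$ is the $\mathscr{P}_\alpha(U_{\mathrm{st}})$-linear map on $2$-forms with $\star_\alpha e^{01}=-e^{23}$, $\star_\alpha e^{02}=e^{13}$, $\star_\alpha e^{03}=-e^{12}$, $\star_\alpha e^{23}=e^{01}$, $\star_\alpha e^{13}=-e^{02}$, $\star_\alpha e^{12}=e^{03}$. *)

theory Defs
  imports "HOL-Analysis.Analysis" "HOL-Library.Poly_Mapping"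
begin

section \<open>Space-time box and fractional polynomials\<close>

text \<open>
  The coordinates of a point \<open>x :: real ^ 4\<close> are \<open>x $ 0 = t\<close> and \<open>x $ 1, x $ 2, x $ 3\<close> (the index
  type \<open>4\<close> has the four elements \<open>0, 1, 2, 3\<close>, and \<open>(4 :: 4) = 0\<close>).  Functions on the box \<open>U\<close> are
  represented by functions on \<open>real ^ 4\<close> of which only the values on \<open>U\<close> matter: equations between
  functions or forms are stated on \<open>U\<close>, and every operator below depends only on values on \<open>U\<close>.
\<close>

definition spacetime_box :: "real \<Rightarrow> real \<Rightarrow> real \<Rightarrow> real \<Rightarrow> (real ^ 4) set" where
  "spacetime_box T b1 b2 b3 =
     {x. x $ 0 \<in> {0..T} \<and> x $ 1 \<in> {0..b1} \<and> x $ 2 \<in> {0..b2} \<and> x $ 3 \<in> {0..b3}}"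

definition frac_coord :: "real \<Rightarrow> 4 \<Rightarrow> real ^ 4 \<Rightarrow> real" where
  "frac_coord \<alpha> \<mu> x = (x $ \<mu>) powr \<alpha> / Gamma (1 + \<alpha>)"

text \<open>
  Real polynomials in four variables are finitely supported maps from exponent vectors
  \<open>m :: nat ^ 4\<close> to coefficients.
\<close>

type_synonym poly4 = "(nat ^ 4) \<Rightarrow>\<^sub>0 real"

definition frac_eval :: "real \<Rightarrow> poly4 \<Rightarrow> real ^ 4 \<Rightarrow> real" where
  "frac_eval \<alpha> p x =
     (\<Sum>m\<in>Poly_Mapping.keys p. Poly_Mapping.lookup p m * (\<Prod>\<nu>\<in>UNIV. frac_coord \<alpha> \<nu> x ^ (m $ \<nu>)))"

definition frac_poly :: "real \<Rightarrow> (real ^ 4) set \<Rightarrow> (real ^ 4 \<Rightarrow> real) set" where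
  "frac_poly \<alpha> U = {f. \<exists>p. \<forall>x\<in>U. f x = frac_eval \<alpha> p x}"

text \<open>
  The polynomial representing \<open>f\<close>; it is unique by algebraic independence of the fractional
  coordinates, see \<open>frac_coeffs_eqI\<close>.
\<close>

definition frac_coeffs :: "real \<Rightarrow> (real ^ 4) set \<Rightarrow> (real ^ 4 \<Rightarrow> real) \<Rightarrow> poly4" where
  "frac_coeffs \<alpha> U f = (THE p. \<forall>x\<in>U. f x = frac_eval \<alpha> p x)"

definition caputo_monomial :: "real \<Rightarrow> 4 \<Rightarrow> nat ^ 4 \<Rightarrow> real ^ 4 \<Rightarrow> real" where
  "caputo_monomial \<alpha> \<mu> m x =
     (if m $ \<mu> \<ge> 1
      then Gamma (real (m $ \<mu>) * \<alpha> + 1) /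
             (Gamma ((real (m $ \<mu>) - 1) * \<alpha> + 1) * Gamma (1 + \<alpha>)) *
           frac_coord \<alpha> \<mu> x ^ (m $ \<mu> - 1) * (\<Prod>\<nu>\<in>UNIV - {\<mu>}. frac_coord \<alpha> \<nu> x ^ (m $ \<nu>))
      else 0)"

text \<open>
  The linear extension of \<open>caputo_monomial\<close>; linearity and the values on monomials are proved
  below (\<open>caputo_add\<close>, \<open>caputo_scale\<close>, \<open>caputo_on_monomial\<close>).
\<close>

definition caputo :: "real \<Rightarrow> (real ^ 4) set \<Rightarrow> 4 \<Rightarrow> (real ^ 4 \<Rightarrow> real) \<Rightarrow> real ^ 4 \<Rightarrow> real" where
  "caputo \<alpha> U \<mu> f x =
     (let p = frac_coeffs \<alpha> U f
      in \<Sum>m\<in>Poly_Mapping.keys p. Poly_Mapping.lookup p m * caputo_monomial \<alpha> \<mu> m x)"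


section \<open>Vector calculus\<close>

text \<open>Spatial fields have components \<open>V x $ 1, V x $ 2, V x $ 3\<close>.\<close>

definition frac_poly_field :: "real \<Rightarrow> (real ^ 4) set \<Rightarrow> (real ^ 4 \<Rightarrow> real ^ 3) set" where
  "frac_poly_field \<alpha> U = {V. \<forall>k. (\<lambda>x. V x $ k) \<in> frac_poly \<alpha> U}"

definition caputo_field ::
    "real \<Rightarrow> (real ^ 4) set \<Rightarrow> 4 \<Rightarrow> (real ^ 4 \<Rightarrow> real ^ 3) \<Rightarrow> real ^ 4 \<Rightarrow> real ^ 3" where
  "caputo_field \<alpha> U \<mu> V x = (\<chi> k. caputo \<alpha> U \<mu> (\<lambda>y. V y $ k) x)"

definition frac_grad :: "real \<Rightarrow> (real ^ 4) set \<Rightarrow> (real ^ 4 \<Rightarrow> real) \<Rightarrow> real ^ 4 \<Rightarrow> real ^ 3" where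
  "frac_grad \<alpha> U f x = vector [caputo \<alpha> U 1 f x, caputo \<alpha> U 2 f x, caputo \<alpha> U 3 f x]"

definition frac_curl ::
    "real \<Rightarrow> (real ^ 4) set \<Rightarrow> (real ^ 4 \<Rightarrow> real ^ 3) \<Rightarrow> real ^ 4 \<Rightarrow> real ^ 3" where
  "frac_curl \<alpha> U V x =
     vector [caputo \<alpha> U 2 (\<lambda>y. V y $ 3) x - caputo \<alpha> U 3 (\<lambda>y. V y $ 2) x,
             caputo \<alpha> U 3 (\<lambda>y. V y $ 1) x - caputo \<alpha> U 1 (\<lambda>y. V y $ 3) x,
             caputo \<alpha> U 1 (\<lambda>y. V y $ 2) x - caputo \<alpha> U 2 (\<lambda>y. V y $ 1) x]"

definition frac_laplace ::
    "real \<Rightarrow> (real ^ 4) set \<Rightarrow> (real ^ 4 \<Rightarrow> real ^ 3) \<Rightarrow> real ^ 4 \<Rightarrow> real ^ 3" where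
  "frac_laplace \<alpha> U V x =
     (\<chi> k. \<Sum>j\<in>{1, 2, 3}. caputo \<alpha> U j (caputo \<alpha> U j (\<lambda>y. V y $ k)) x)"

definition frac_box ::
    "real \<Rightarrow> (real ^ 4) set \<Rightarrow> (real ^ 4 \<Rightarrow> real ^ 3) \<Rightarrow> real ^ 4 \<Rightarrow> real ^ 3" where
  "frac_box \<alpha> U V x =
     caputo_field \<alpha> U 0 (caputo_field \<alpha> U 0 V) x - frac_laplace \<alpha> U V x"


section \<open>Exterior algebra and forms\<close>

text \<open>
  The real exterior algebra on \<open>e 0, e 1, e 2, e 3\<close> is \<open>real ^ (4 set)\<close>: the coordinate at
  \<open>I = {i\<^sub>1 < ... < i\<^sub>k}\<close> is the coefficient of \<open>e i\<^sub>1 \<and> ... \<and> e i\<^sub>k\<close>.  Forms are functions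
  \<open>real ^ 4 \<Rightarrow> ext4\<close>; they are forms with coefficients in the fractional polynomials iff each
  component function is a fractional polynomial.
\<close>

type_synonym ext4 = "real ^ (4 set)"

definition wedge_sign :: "4 set \<Rightarrow> 4 set \<Rightarrow> real" where
  "wedge_sign I J =
     (if I \<inter> J = {} then (- 1) ^ card {(i, j). i \<in> I \<and> j \<in> J \<and> j < i} else 0)"

definition wedge :: "ext4 \<Rightarrow> ext4 \<Rightarrow> ext4" (infixl "\<and>\<^sub>e" 75) where
  "u \<and>\<^sub>e v = (\<Sum>I\<in>UNIV. \<Sum>J\<in>UNIV. (u $ I * v $ J * wedge_sign I J) *\<^sub>R axis (I \<union> J) 1)"

definition gen :: "4 \<Rightarrow> ext4" where
  "gen \<mu> = axis {\<mu>} 1"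

definition frac_d :: "real \<Rightarrow> (real ^ 4) set \<Rightarrow> (real ^ 4 \<Rightarrow> ext4) \<Rightarrow> real ^ 4 \<Rightarrow> ext4" where
  "frac_d \<alpha> U \<omega> x =
     (\<Sum>I\<in>UNIV. \<Sum>\<mu>\<in>UNIV. caputo \<alpha> U \<mu> (\<lambda>y. \<omega> y $ I) x *\<^sub>R (gen \<mu> \<and>\<^sub>e axis I 1))"

text \<open>
  The Hodge-type operator is linear over the coefficients, so it acts pointwise.  Only its values
  on 2-forms are meaningful; on other degrees it returns 0.
\<close>

definition hodge :: "ext4 \<Rightarrow> ext4" where
  "hodge w =
     w $ {0, 1} *\<^sub>R (- (gen 2 \<and>\<^sub>e gen 3)) + w $ {0, 2} *\<^sub>R (gen 1 \<and>\<^sub>e gen 3) +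
     w $ {0, 3} *\<^sub>R (- (gen 1 \<and>\<^sub>e gen 2)) + w $ {2, 3} *\<^sub>R (gen 0 \<and>\<^sub>e gen 1) +
     w $ {1, 3} *\<^sub>R (- (gen 0 \<and>\<^sub>e gen 2)) + w $ {1, 2} *\<^sub>R (gen 0 \<and>\<^sub>e gen 3)"

definition faraday :: "(real ^ 4 \<Rightarrow> real ^ 3) \<Rightarrow> (real ^ 4 \<Rightarrow> real ^ 3) \<Rightarrow> real ^ 4 \<Rightarrow> ext4" where
  "faraday E B x =
     - (E x $ 1) *\<^sub>R (gen 0 \<and>\<^sub>e gen 1) - (E x $ 2) *\<^sub>R (gen 0 \<and>\<^sub>e gen 2)
     - (E x $ 3) *\<^sub>R (gen 0 \<and>\<^sub>e gen 3) + (B x $ 1) *\<^sub>R (gen 2 \<and>\<^sub>e gen 3)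
     - (B x $ 2) *\<^sub>R (gen 1 \<and>\<^sub>e gen 3) + (B x $ 3) *\<^sub>R (gen 1 \<and>\<^sub>e gen 2)"

definition current :: "(real ^ 4 \<Rightarrow> real) \<Rightarrow> (real ^ 4 \<Rightarrow> real ^ 3) \<Rightarrow> real ^ 4 \<Rightarrow> ext4" where
  "current \<rho> J x =
     \<rho> x *\<^sub>R (gen 1 \<and>\<^sub>e gen 2 \<and>\<^sub>e gen 3) - (J x $ 1) *\<^sub>R (gen 0 \<and>\<^sub>e gen 2 \<and>\<^sub>e gen 3)
     + (J x $ 2) *\<^sub>R (gen 0 \<and>\<^sub>e gen 1 \<and>\<^sub>e gen 3) - (J x $ 3) *\<^sub>R (gen 0 \<and>\<^sub>e gen 1 \<and>\<^sub>e gen 2)"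

definition frac_maxwell ::
    "real \<Rightarrow> (real ^ 4) set \<Rightarrow> (real ^ 4 \<Rightarrow> ext4) \<Rightarrow> (real ^ 4 \<Rightarrow> ext4) \<Rightarrow> bool" where
  "frac_maxwell \<alpha> U F \<J> \<longleftrightarrow>
     (\<forall>x\<in>U. frac_d \<alpha> U F x = 0) \<and> (\<forall>x\<in>U. frac_d \<alpha> U (\<lambda>y. hodge (F y)) x = \<J> x)"


section \<open>Algebraic independence and well-definedness\<close>

lemma vanishing_coeffs:
  fixes c :: "nat ^ 'n \<Rightarrow> real" and S :: "'n :: finite \<Rightarrow> real set"
  assumes "finite A" "finite M" "\<And>\<mu>. infinite (S \<mu>)"
    and "\<And>z. (\<And>\<mu>. z \<mu> \<in> S \<mu>) \<Longrightarrow> (\<Sum>m\<in>M. c m * (\<Prod>\<mu>\<in>A. z \<mu> ^ (m $ \<mu>))) = 0"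
  shows "(\<Sum>m | m \<in> M \<and> (\<forall>\<mu>\<in>A. m $ \<mu> = m0 $ \<mu>). c m) = 0"
  using assms(1,2,4)
proof (induction A arbitrary: M rule: finite_induct)
  case empty
  have "\<forall>\<mu>. \<exists>r. r \<in> S \<mu>"
    using assms(3) by (metis finite.emptyI ex_in_conv)
  then obtain z where z: "\<And>\<mu>. z \<mu> \<in> S \<mu>"
    by metis
  show ?case
    using empty(2)[of z] z by simp
next
  case (insert a A)
  define M' where "M' k = {m \<in> M. m $ a = k}" for k
  have fin: "finite (M' k)" for k
    using insert.prems(1) by (simp add: M'_def)
  have "(\<Sum>m\<in>M' k. c m * (\<Prod>\<mu>\<in>A. z \<mu> ^ (m $ \<mu>))) = 0" if z: "\<And>\<mu>. z \<mu> \<in> S \<mu>" for z k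
  proof (rule ccontr)
    define q where "q k = (\<Sum>m\<in>M' k. c m * (\<Prod>\<mu>\<in>A. z \<mu> ^ (m $ \<mu>)))" for k
    assume "(\<Sum>m\<in>M' k. c m * (\<Prod>\<mu>\<in>A. z \<mu> ^ (m $ \<mu>))) \<noteq> 0"
    hence qk: "q k \<noteq> 0"
      by (simp add: q_def)
    define N where "N = max k (Max (insert 0 ((\<lambda>m. m $ a) ` M)))"
    have N: "m $ a \<le> N" if "m \<in> M" for m
      using that insert.prems(1) by (auto simp: N_def le_max_iff_disj intro!: disjI2)
    have "(\<Sum>i\<le>N. q i * t ^ i) = 0" if t: "t \<in> S a" for t
    proof -
      have "(\<Sum>i\<le>N. q i * t ^ i) =
            (\<Sum>i\<le>N. \<Sum>m\<in>M' i. c m * (\<Prod>\<mu>\<in>insert a A. (z(a := t)) \<mu> ^ (m $ \<mu>)))"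
      proof (rule sum.cong[OF refl])
        fix i
        have "c m * (\<Prod>\<mu>\<in>A. z \<mu> ^ (m $ \<mu>)) * t ^ i =
              c m * (\<Prod>\<mu>\<in>insert a A. (z(a := t)) \<mu> ^ (m $ \<mu>))" if "m \<in> M' i" for m
        proof -
          have "(\<Prod>\<mu>\<in>A. (z(a := t)) \<mu> ^ (m $ \<mu>)) = (\<Prod>\<mu>\<in>A. z \<mu> ^ (m $ \<mu>))"
            using insert.hyps by (intro prod.cong) auto
          thus ?thesis
            using insert.hyps that by (simp add: M'_def)
        qed
        thus "q i * t ^ i =
              (\<Sum>m\<in>M' i. c m * (\<Prod>\<mu>\<in>insert a A. (z(a := t)) \<mu> ^ (m $ \<mu>)))"
          unfolding q_def sum_distrib_right by (rule sum.cong[OF refl])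
      qed
      also have "\<dots> = (\<Sum>m\<in>M. c m * (\<Prod>\<mu>\<in>insert a A. (z(a := t)) \<mu> ^ (m $ \<mu>)))"
        unfolding M'_def using N insert.prems(1) by (intro sum.group) auto
      also have "\<dots> = 0"
        using z t by (intro insert.prems(2)) auto
      finally show ?thesis .
    qed
    hence "S a \<subseteq> {t. (\<Sum>i\<le>N. q i * t ^ i) = 0}"
      by auto
    moreover have "finite {t. (\<Sum>i\<le>N. q i * t ^ i) = 0}"
      using polyfun_rootbound[of N q] qk by (metis N_def max.cobounded1)
    ultimately show False
      using assms(3) finite_subset by blast
  qed
  hence "(\<Sum>m | m \<in> M' (m0 $ a) \<and> (\<forall>\<mu>\<in>A. m $ \<mu> = m0 $ \<mu>). c m) = 0"
    using fin by (intro insert.IH) auto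
  thus ?case
    by (simp add: M'_def conj_assoc)
qed

lemma frac_coord_surj:
  assumes "\<alpha> > 0" and z: "\<And>\<mu>. 0 \<le> z \<mu>"
  shows "frac_coord \<alpha> \<mu> (\<chi> \<nu>. (Gamma (1 + \<alpha>) * z \<nu>) powr (1 / \<alpha>)) = z \<mu>"
proof -
  have "Gamma (1 + \<alpha>) > 0"
    using assms by (intro Gamma_real_pos) auto
  moreover from this have "Gamma (1 + \<alpha>) \<noteq> 0"
    by simp
  ultimately show ?thesis
    using assms(1) z[of \<mu>] by (simp add: frac_coord_def powr_powr)
qed

lemma frac_eval_eq_0:
  assumes "0 < \<alpha>" "0 < T" "0 < b1" "0 < b2" "0 < b3"
    and van: "\<And>x. x \<in> spacetime_box T b1 b2 b3 \<Longrightarrow> frac_eval \<alpha> p x = 0"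
  shows "p = 0"
proof (rule poly_mapping_eqI)
  fix m0 :: "nat ^ 4"
  define r where "r = Min {T, b1, b2, b3}"
  have r: "r > 0" "r \<le> T" "r \<le> b1" "r \<le> b2" "r \<le> b3"
    using assms by (auto simp: r_def)
  have G: "Gamma (1 + \<alpha>) > 0"
    using assms by (intro Gamma_real_pos) auto
  define R where "R = r powr \<alpha> / Gamma (1 + \<alpha>)"
  have R: "R > 0"
    using r G by (simp add: R_def)
  have "(\<Sum>m\<in>Poly_Mapping.keys p. Poly_Mapping.lookup p m * (\<Prod>\<nu>\<in>UNIV. z \<nu> ^ (m $ \<nu>))) = 0"
    if z: "\<And>\<mu>. z \<mu> \<in> {0..R}" for z
  proof -
    define x :: "real ^ 4" where "x = (\<chi> \<nu>. (Gamma (1 + \<alpha>) * z \<nu>) powr (1 / \<alpha>))"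
    have "x $ \<nu> \<in> {0..r}" for \<nu>
    proof -
      have "Gamma (1 + \<alpha>) * z \<nu> \<le> r powr \<alpha>"
        using z[of \<nu>] G by (simp add: R_def field_simps)
      hence "(Gamma (1 + \<alpha>) * z \<nu>) powr (1 / \<alpha>) \<le> (r powr \<alpha>) powr (1 / \<alpha>)"
        using z[of \<nu>] G assms by (intro powr_mono2) auto
      thus ?thesis
        using r assms by (simp add: x_def powr_powr)
    qed
    hence "x \<in> spacetime_box T b1 b2 b3"
      using r by (force simp: spacetime_box_def intro: order_trans)
    moreover have "frac_coord \<alpha> \<nu> x = z \<nu>" for \<nu>
      unfolding x_def using z assms by (intro frac_coord_surj) auto
    ultimately show ?thesis
      using van[of x] by (simp add: frac_eval_def)
  qed
  hence *: "(\<Sum>m | m \<in> Poly_Mapping.keys p \<and> (\<forall>\<mu>\<in>UNIV. m $ \<mu> = m0 $ \<mu>). Poly_Mapping.lookup p m) = 0"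
    using R by (intro vanishing_coeffs[where S = "\<lambda>_. {0..R}"]) auto
  have "{m. m \<in> Poly_Mapping.keys p \<and> (\<forall>\<mu>\<in>UNIV. m $ \<mu> = m0 $ \<mu>)} =
        (if m0 \<in> Poly_Mapping.keys p then {m0} else {})"
    by (auto simp flip: vec_eq_iff)
  with * show "Poly_Mapping.lookup p m0 = Poly_Mapping.lookup 0 m0"
    by (auto simp: in_keys_iff split: if_splits)
qed

lemma sum_keys_superset:
  assumes "finite A" "Poly_Mapping.keys p \<subseteq> A"
  shows "(\<Sum>m\<in>Poly_Mapping.keys p. Poly_Mapping.lookup p m * g m) =
         (\<Sum>m\<in>A. Poly_Mapping.lookup p m * (g m :: real))"
  using assms by (intro sum.mono_neutral_left) (auto simp: in_keys_iff)

lemma sum_keys_add: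
  "(\<Sum>m\<in>Poly_Mapping.keys (p + q). Poly_Mapping.lookup (p + q) m * (g m :: real)) =
   (\<Sum>m\<in>Poly_Mapping.keys p. Poly_Mapping.lookup p m * g m) +
   (\<Sum>m\<in>Poly_Mapping.keys q. Poly_Mapping.lookup q m * g m)"
proof -
  define A where "A = Poly_Mapping.keys p \<union> Poly_Mapping.keys q"
  have A: "finite A" "Poly_Mapping.keys p \<subseteq> A" "Poly_Mapping.keys q \<subseteq> A"
    "Poly_Mapping.keys (p + q) \<subseteq> A"
    using Poly_Mapping.keys_add[of p q] by (auto simp: A_def)
  show ?thesis
    unfolding sum_keys_superset[OF A(1,2)] sum_keys_superset[OF A(1,3)] sum_keys_superset[OF A(1,4)]
    by (simp add: lookup_add distrib_right sum.distrib)
qed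

lemma lookup_map_scale:
  "Poly_Mapping.lookup (Poly_Mapping.map ((*) c) p) m = c * (Poly_Mapping.lookup p m :: real)"
  by (simp add: Poly_Mapping.map.rep_eq when_def)

lemma sum_keys_scale:
  "(\<Sum>m\<in>Poly_Mapping.keys (Poly_Mapping.map ((*) c) p). Poly_Mapping.lookup (Poly_Mapping.map ((*) c) p) m * (g m :: real)) =
   c * (\<Sum>m\<in>Poly_Mapping.keys p. Poly_Mapping.lookup p m * g m)"
proof -
  have "Poly_Mapping.keys (Poly_Mapping.map ((*) c) p) \<subseteq> Poly_Mapping.keys p"
    by (auto simp: in_keys_iff lookup_map_scale)
  from sum_keys_superset[OF finite_keys this] show ?thesis
    by (simp only: lookup_map_scale sum_distrib_left mult.assoc)
qed

context
  fixes \<alpha> T b1 b2 b3 :: real and U :: "(real ^ 4) set"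
  assumes pos: "0 < \<alpha>" "0 < T" "0 < b1" "0 < b2" "0 < b3"
  defines "U \<equiv> spacetime_box T b1 b2 b3"
begin

lemma frac_coeffs_eqI:
  assumes "\<And>x. x \<in> U \<Longrightarrow> f x = frac_eval \<alpha> p x"
  shows "frac_coeffs \<alpha> U f = p"
  unfolding frac_coeffs_def
proof (rule the_equality)
  show "\<forall>x\<in>U. f x = frac_eval \<alpha> p x"
    using assms by blast
next
  fix q assume q: "\<forall>x\<in>U. f x = frac_eval \<alpha> q x"
  have "frac_eval \<alpha> (q + Poly_Mapping.map ((*) (- 1)) p) x = 0" if "x \<in> U" for x
    using q assms that unfolding frac_eval_def sum_keys_add sum_keys_scale by simp
  hence "q + Poly_Mapping.map ((*) (- 1)) p = 0"
    using pos unfolding U_def by (intro frac_eval_eq_0)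
  hence "Poly_Mapping.lookup (q + Poly_Mapping.map ((*) (- 1)) p) m = 0" for m
    by simp
  thus "q = p"
    by (intro poly_mapping_eqI)
      (metis add_eq_0_iff2 lookup_add lookup_map_scale minus_minus mult_minus1)
qed

lemma caputo_eq:
  assumes "\<And>x. x \<in> U \<Longrightarrow> f x = frac_eval \<alpha> p x"
  shows "caputo \<alpha> U \<mu> f x =
           (\<Sum>m\<in>Poly_Mapping.keys p. Poly_Mapping.lookup p m * caputo_monomial \<alpha> \<mu> m x)"
proof -
  have "frac_coeffs \<alpha> U f = p"
    using assms by (rule frac_coeffs_eqI)
  thus ?thesis
    by (simp only: caputo_def Let_def)
qed

lemma caputo_add:
  assumes "f \<in> frac_poly \<alpha> U" "g \<in> frac_poly \<alpha> U"
  shows "caputo \<alpha> U \<mu> (\<lambda>x. f x + g x) x = caputo \<alpha> U \<mu> f x + caputo \<alpha> U \<mu> g x"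
proof -
  obtain p q where pq: "\<And>x. x \<in> U \<Longrightarrow> f x = frac_eval \<alpha> p x" "\<And>x. x \<in> U \<Longrightarrow> g x = frac_eval \<alpha> q x"
    using assms by (auto simp: frac_poly_def)
  have "f x + g x = frac_eval \<alpha> (p + q) x" if "x \<in> U" for x
    using pq that unfolding frac_eval_def sum_keys_add by simp
  from caputo_eq[OF this] caputo_eq[OF pq(1)] caputo_eq[OF pq(2)] show ?thesis
    by (simp only: sum_keys_add)
qed

lemma caputo_scale:
  assumes "f \<in> frac_poly \<alpha> U"
  shows "caputo \<alpha> U \<mu> (\<lambda>x. c * f x) x = c * caputo \<alpha> U \<mu> f x"
proof -
  obtain p where p: "\<And>x. x \<in> U \<Longrightarrow> f x = frac_eval \<alpha> p x"
    using assms by (auto simp: frac_poly_def)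
  have "c * f x = frac_eval \<alpha> (Poly_Mapping.map ((*) c) p) x" if "x \<in> U" for x
    using p that unfolding frac_eval_def sum_keys_scale by simp
  from caputo_eq[OF this] caputo_eq[OF p] show ?thesis
    by (simp only: sum_keys_scale)
qed

lemma caputo_on_monomial:
  "caputo \<alpha> U \<mu> (\<lambda>x. \<Prod>\<nu>\<in>UNIV. frac_coord \<alpha> \<nu> x ^ (m $ \<nu>)) x = caputo_monomial \<alpha> \<mu> m x"
  by (subst caputo_eq[where p = "Poly_Mapping.single m 1"]) (auto simp: frac_eval_def)

end


section \<open>Relations of the exterior algebra\<close>

lemma wedge_axis:
  "axis I 1 \<and>\<^sub>e axis J 1 = wedge_sign I J *\<^sub>R axis (I \<union> J) 1"
proof -
  have "axis I 1 \<and>\<^sub>e axis J 1 = (\<Sum>I'\<in>UNIV. \<Sum>J'\<in>UNIV.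
      if J' = J then if I' = I then wedge_sign I J *\<^sub>R axis (I \<union> J) 1 else 0 else 0)"
    unfolding wedge_def by (intro sum.cong refl) (auto simp: axis_def)
  thus ?thesis by simp
qed

lemma gen_wedge_self: "gen \<mu> \<and>\<^sub>e gen \<mu> = 0"
  by (simp add: gen_def wedge_axis wedge_sign_def)

lemma wedge_sign_single:
  "wedge_sign {\<mu>} {\<nu>} = (if \<mu> < \<nu> then 1 else if \<nu> < \<mu> then - 1 else 0)"
proof -
  have eq: "{(i, j). i \<in> {\<mu>} \<and> j \<in> {\<nu>} \<and> j < i} = (if \<nu> < \<mu> then {(\<mu>, \<nu>)} else {})"
    by auto
  show ?thesis
    unfolding wedge_sign_def eq by auto
qed

lemma gen_wedge_less: "\<mu> < \<nu> \<Longrightarrow> gen \<mu> \<and>\<^sub>e gen \<nu> = axis {\<mu>, \<nu>} 1"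
  by (simp add: gen_def wedge_axis wedge_sign_single insert_commute[of \<nu> \<mu>])

lemma gen_wedge_anticommute: "gen \<mu> \<and>\<^sub>e gen \<nu> = - (gen \<nu> \<and>\<^sub>e gen \<mu>)"
  by (auto simp: gen_def wedge_axis wedge_sign_single insert_commute[of \<nu> \<mu>])

lemma less_4: "(0::4) < 1" "(1::4) < 2" "(2::4) < 3" "(0::4) < 2" "(0::4) < 3" "(1::4) < 3"
  by (simp_all add: less_bit0_def bit0.Rep_0 bit0.Rep_1 bit0.Rep_numeral)

lemma wedge_sign_assoc:
  "wedge_sign I J * wedge_sign (I \<union> J) K = wedge_sign J K * wedge_sign I (J \<union> K)"
proof (cases "I \<inter> J = {} \<and> I \<inter> K = {} \<and> J \<inter> K = {}")
  case True
  define inv where "inv A B = {(i, j). i \<in> A \<and> j \<in> B \<and> j < i}" for A B :: "4 set"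
  have fin: "finite (inv A B)" for A B
    by (rule finite_subset[OF subset_UNIV]) simp
  have "inv (I \<union> J) K = inv I K \<union> inv J K" "inv I K \<inter> inv J K = {}"
    "inv I (J \<union> K) = inv I J \<union> inv I K" "inv I J \<inter> inv I K = {}"
    using True by (auto simp: inv_def)
  hence "card (inv (I \<union> J) K) = card (inv I K) + card (inv J K)"
    "card (inv I (J \<union> K)) = card (inv I J) + card (inv I K)"
    using fin by (simp_all add: card_Un_disjoint)
  moreover have "wedge_sign A B = (- 1) ^ card (inv A B)" if "A \<inter> B = {}" for A B
    using that by (simp add: wedge_sign_def inv_def)
  moreover have "(I \<union> J) \<inter> K = {}" "I \<inter> (J \<union> K) = {}"
    using True by auto
  ultimately show ?thesis
    using True by (simp add: power_add)
next
  case False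
  thus ?thesis
    by (auto simp: wedge_sign_def)
qed

lemma wedge_sum_left: "(\<Sum>i\<in>A. f i) \<and>\<^sub>e v = (\<Sum>i\<in>A. f i \<and>\<^sub>e v)"
proof (induction A rule: infinite_finite_induct)
  case (insert a A)
  have "(x + y) \<and>\<^sub>e v = x \<and>\<^sub>e v + y \<and>\<^sub>e v" for x y
    by (simp add: wedge_def algebra_simps sum.distrib)
  with insert show ?case by simp
qed (simp_all add: wedge_def)

lemma wedge_sum_right: "u \<and>\<^sub>e (\<Sum>i\<in>A. f i) = (\<Sum>i\<in>A. u \<and>\<^sub>e f i)"
proof (induction A rule: infinite_finite_induct)
  case (insert a A)
  have "u \<and>\<^sub>e (x + y) = u \<and>\<^sub>e x + u \<and>\<^sub>e y" for x y
    by (simp add: wedge_def algebra_simps sum.distrib)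
  with insert show ?case by simp
qed (simp_all add: wedge_def)

lemma wedge_scale_left: "(c *\<^sub>R u) \<and>\<^sub>e v = c *\<^sub>R (u \<and>\<^sub>e v)"
  by (simp add: wedge_def scaleR_sum_right mult.assoc)

lemma wedge_scale_right: "u \<and>\<^sub>e (c *\<^sub>R v) = c *\<^sub>R (u \<and>\<^sub>e v)"
  by (simp add: wedge_def scaleR_sum_right mult.assoc mult.left_commute)

lemma wedge_assoc: "(u \<and>\<^sub>e v) \<and>\<^sub>e w = u \<and>\<^sub>e (v \<and>\<^sub>e w)"
proof -
  have exp: "x = (\<Sum>I\<in>UNIV. x $ I *\<^sub>R axis I 1)" for x :: ext4
    by (simp add: vec_eq_iff axis_def if_distrib[of "\<lambda>t. _ * t"] cong: if_cong)
  have basis: "(axis I 1 \<and>\<^sub>e axis J 1) \<and>\<^sub>e axis K 1 = axis I 1 \<and>\<^sub>e (axis J 1 \<and>\<^sub>e axis K 1)" for I J K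
    by (simp add: wedge_axis wedge_scale_left wedge_scale_right wedge_sign_assoc Un_assoc)
  have 1: "(axis I 1 \<and>\<^sub>e axis J 1) \<and>\<^sub>e (\<Sum>K\<in>UNIV. c K *\<^sub>R axis K 1) =
      axis I 1 \<and>\<^sub>e (axis J 1 \<and>\<^sub>e (\<Sum>K\<in>UNIV. c K *\<^sub>R axis K 1))" for I J c
    by (simp only: wedge_sum_right wedge_scale_right basis)
  have 2: "(axis I 1 \<and>\<^sub>e axis J 1) \<and>\<^sub>e w = axis I 1 \<and>\<^sub>e (axis J 1 \<and>\<^sub>e w)" for I J
    using 1[of I J "\<lambda>K. w $ K"] by (simp only: exp[symmetric])
  have 3: "(axis I 1 \<and>\<^sub>e (\<Sum>J\<in>UNIV. b J *\<^sub>R axis J 1)) \<and>\<^sub>e w =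
      axis I 1 \<and>\<^sub>e ((\<Sum>J\<in>UNIV. b J *\<^sub>R axis J 1) \<and>\<^sub>e w)" for I b
    by (simp only: wedge_sum_left wedge_sum_right wedge_scale_left wedge_scale_right 2)
  have 4: "(axis I 1 \<and>\<^sub>e v) \<and>\<^sub>e w = axis I 1 \<and>\<^sub>e (v \<and>\<^sub>e w)" for I
    using 3[of I "\<lambda>K. v $ K"] by (simp only: exp[symmetric])
  have "((\<Sum>I\<in>UNIV. a I *\<^sub>R axis I 1) \<and>\<^sub>e v) \<and>\<^sub>e w = (\<Sum>I\<in>UNIV. a I *\<^sub>R axis I 1) \<and>\<^sub>e (v \<and>\<^sub>e w)" for a
    by (simp only: wedge_sum_left wedge_scale_left 4)
  from this[of "\<lambda>K. u $ K"] show ?thesis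
    by (simp only: exp[symmetric])
qed

end

theory Submission
  imports Defs
begin

text \<open>
  The theorem is the classical derivation of the wave equations from Maxwell's equations.  That
  derivation rests on two properties of partial derivatives, linearity and commutation, and the Caputo
  operators share both.

  The operators commute because each of them sends a monomial in the fractional coordinates to a
  multiple of a monomial with one exponent lowered, where the factor depends on that exponent alone
  (\<open>caputo_monomial_eq\<close>, \<open>caputo_commute\<close>).

  On the side of forms one computation suffices.  The exterior derivative of a Faraday form is again
  a form of the shape of a current (\<open>frac_d_faraday\<close>):
  the current with charge density \<open>div B\<close> and current density \<open>- (\<partial>\<^sub>t B + curl E)\<close>.  The Hodge-type
  operator exchanges the two fields, \<open>(E, B) \<mapsto> (- B, E)\<close> (\<open>hodge_faraday\<close>), so that the same
  computation also treats the inhomogeneous equation, and comparing coefficients gives the four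
  vector equations (\<open>frac_maxwell_faraday_iff\<close>).

  The vector equations are symmetric under the same exchange: both \<open>(B, E)\<close> and \<open>(E, - B)\<close> solve a
  system \<open>\<partial>\<^sub>t X = - curl Y - M\<close>, \<open>\<partial>\<^sub>t Y = curl X - N\<close>, \<open>div X = \<sigma>\<close>.  Any such system
  yields \<open>\<box> X = curl N - \<partial>\<^sub>t M - grad \<sigma>\<close> (\<open>wave_equation_of_first_order_system\<close>), and the two
  choices of \<open>(X, Y)\<close> are the two wave equations.
\<close>


section \<open>Caputo operators on fractional polynomials\<close>

lemma caputo_cong:
  assumes "\<And>x. x \<in> U \<Longrightarrow> f x = g x"
  shows "caputo \<alpha> U \<mu> f = caputo \<alpha> U \<mu> g"
proof -
  have "frac_coeffs \<alpha> U f = frac_coeffs \<alpha> U g"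
    unfolding frac_coeffs_def using assms by (intro arg_cong[where f = The] ext) auto
  thus ?thesis
    by (simp add: caputo_def fun_eq_iff)
qed

lemma frac_poly_add:
  assumes "f \<in> frac_poly \<alpha> U" "g \<in> frac_poly \<alpha> U"
  shows "(\<lambda>x. f x + g x) \<in> frac_poly \<alpha> U"
proof -
  obtain p q where "\<forall>x\<in>U. f x = frac_eval \<alpha> p x" "\<forall>x\<in>U. g x = frac_eval \<alpha> q x"
    using assms by (auto simp: frac_poly_def)
  hence "\<forall>x\<in>U. f x + g x = frac_eval \<alpha> (p + q) x"
    unfolding frac_eval_def sum_keys_add by simp
  thus ?thesis
    by (auto simp: frac_poly_def)
qed

lemma frac_poly_scale:
  assumes "f \<in> frac_poly \<alpha> U"
  shows "(\<lambda>x. c * f x) \<in> frac_poly \<alpha> U"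
proof -
  obtain p where "\<forall>x\<in>U. f x = frac_eval \<alpha> p x"
    using assms by (auto simp: frac_poly_def)
  hence "\<forall>x\<in>U. c * f x = frac_eval \<alpha> (Poly_Mapping.map ((*) c) p) x"
    unfolding frac_eval_def sum_keys_scale by simp
  thus ?thesis
    by (auto simp: frac_poly_def)
qed

lemma frac_poly_minus: "f \<in> frac_poly \<alpha> U \<Longrightarrow> (\<lambda>x. - f x) \<in> frac_poly \<alpha> U"
  using frac_poly_scale[of f \<alpha> U "- 1"] by simp

lemma frac_poly_diff:
  "f \<in> frac_poly \<alpha> U \<Longrightarrow> g \<in> frac_poly \<alpha> U \<Longrightarrow> (\<lambda>x. f x - g x) \<in> frac_poly \<alpha> U"
  using frac_poly_add[of f \<alpha> U "\<lambda>x. - g x"] frac_poly_minus[of g \<alpha> U] by simp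

lemma frac_poly_zero: "(\<lambda>x. 0) \<in> frac_poly \<alpha> U"
  by (auto simp: frac_poly_def frac_eval_def intro!: exI[of _ 0])

lemma frac_poly_sum:
  assumes "\<And>i. i \<in> A \<Longrightarrow> f i \<in> frac_poly \<alpha> U"
  shows "(\<lambda>x. \<Sum>i\<in>A. f i x) \<in> frac_poly \<alpha> U"
  using assms
  by (induction A rule: infinite_finite_induct) (simp_all add: frac_poly_zero frac_poly_add)

lemma frac_poly_monomial:
  "(\<lambda>x. \<Prod>\<nu>\<in>UNIV. frac_coord \<alpha> \<nu> x ^ (m $ \<nu>)) \<in> frac_poly \<alpha> U"
  by (auto simp: frac_poly_def frac_eval_def intro!: exI[of _ "Poly_Mapping.single m 1"])

text \<open>The value \<open>0\<close> at \<open>n = 0\<close> absorbs the case distinction in \<open>caputo_monomial\<close>.\<close>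

definition caputo_factor :: "real \<Rightarrow> nat \<Rightarrow> real" where
  "caputo_factor \<alpha> n =
     (if n \<ge> 1 then Gamma (real n * \<alpha> + 1) / (Gamma ((real n - 1) * \<alpha> + 1) * Gamma (1 + \<alpha>)) else 0)"

definition lower_exponent :: "4 \<Rightarrow> nat ^ 4 \<Rightarrow> nat ^ 4" where
  "lower_exponent \<mu> m = (\<chi> \<nu>. if \<nu> = \<mu> then m $ \<nu> - 1 else m $ \<nu>)"

lemma caputo_monomial_eq:
  "caputo_monomial \<alpha> \<mu> m x =
     caputo_factor \<alpha> (m $ \<mu>) * (\<Prod>\<nu>\<in>UNIV. frac_coord \<alpha> \<nu> x ^ (lower_exponent \<mu> m $ \<nu>))"
proof -
  have "(\<Prod>\<nu>\<in>UNIV. frac_coord \<alpha> \<nu> x ^ (lower_exponent \<mu> m $ \<nu>)) =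
      frac_coord \<alpha> \<mu> x ^ (m $ \<mu> - 1) *
      (\<Prod>\<nu>\<in>UNIV - {\<mu>}. frac_coord \<alpha> \<nu> x ^ (lower_exponent \<mu> m $ \<nu>))"
    by (subst prod.remove[of UNIV \<mu>]) (simp_all add: lower_exponent_def)
  also have "(\<Prod>\<nu>\<in>UNIV - {\<mu>}. frac_coord \<alpha> \<nu> x ^ (lower_exponent \<mu> m $ \<nu>)) =
      (\<Prod>\<nu>\<in>UNIV - {\<mu>}. frac_coord \<alpha> \<nu> x ^ (m $ \<nu>))"
    by (intro prod.cong) (auto simp: lower_exponent_def)
  finally show ?thesis
    by (simp add: caputo_monomial_def caputo_factor_def)
qed

lemma frac_poly_caputo_monomial: "caputo_monomial \<alpha> \<mu> m \<in> frac_poly \<alpha> U"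
  unfolding caputo_monomial_eq[abs_def] by (intro frac_poly_scale frac_poly_monomial)

context
  fixes \<alpha> T b1 b2 b3 :: real and U :: "(real ^ 4) set"
  assumes pos: "0 < \<alpha>" "0 < T" "0 < b1" "0 < b2" "0 < b3"
  defines "U \<equiv> spacetime_box T b1 b2 b3"
begin

lemmas caputo_linear =
  caputo_add[OF pos, folded U_def] caputo_scale[OF pos, folded U_def]

lemma caputo_minus:
  "f \<in> frac_poly \<alpha> U \<Longrightarrow> caputo \<alpha> U \<mu> (\<lambda>x. - f x) x = - caputo \<alpha> U \<mu> f x"
  using caputo_linear(2)[of f \<mu> "- 1" x] by simp

lemma caputo_diff:
  assumes "f \<in> frac_poly \<alpha> U" "g \<in> frac_poly \<alpha> U"
  shows "caputo \<alpha> U \<mu> (\<lambda>x. f x - g x) x = caputo \<alpha> U \<mu> f x - caputo \<alpha> U \<mu> g x"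
  using caputo_linear(1)[of f "\<lambda>x. - g x" \<mu> x] assms by (simp add: frac_poly_minus caputo_minus)

lemma caputo_zero: "caputo \<alpha> U \<mu> (\<lambda>x. 0) x = 0"
  using caputo_linear(2)[OF frac_poly_zero, of \<mu> 0 x] by simp

lemma caputo_sum:
  assumes "\<And>i. i \<in> A \<Longrightarrow> f i \<in> frac_poly \<alpha> U"
  shows "caputo \<alpha> U \<mu> (\<lambda>x. \<Sum>i\<in>A. f i x) x = (\<Sum>i\<in>A. caputo \<alpha> U \<mu> (f i) x)"
  using assms
  by (induction A rule: infinite_finite_induct)
    (simp_all add: caputo_zero caputo_linear(1) frac_poly_sum)

lemma caputo_expansion:
  assumes "f \<in> frac_poly \<alpha> U"
  obtains p where "\<And>\<mu>. caputo \<alpha> U \<mu> f =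
    (\<lambda>x. \<Sum>m\<in>Poly_Mapping.keys p. Poly_Mapping.lookup p m * caputo_monomial \<alpha> \<mu> m x)"
proof -
  obtain p where "\<And>x. x \<in> U \<Longrightarrow> f x = frac_eval \<alpha> p x"
    using assms by (auto simp: frac_poly_def)
  from caputo_eq[OF pos, folded U_def, OF this] show ?thesis
    using that by blast
qed

lemma frac_poly_caputo:
  assumes "f \<in> frac_poly \<alpha> U"
  shows "caputo \<alpha> U \<mu> f \<in> frac_poly \<alpha> U"
proof -
  obtain p where p: "\<And>\<mu>. caputo \<alpha> U \<mu> f =
      (\<lambda>x. \<Sum>m\<in>Poly_Mapping.keys p. Poly_Mapping.lookup p m * caputo_monomial \<alpha> \<mu> m x)"
    using caputo_expansion[OF assms] by blast
  show ?thesis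
    unfolding p by (intro frac_poly_sum frac_poly_scale frac_poly_caputo_monomial)
qed

lemma caputo_caputo_monomial:
  "caputo \<alpha> U \<mu> (caputo_monomial \<alpha> \<nu> m) x =
     caputo_factor \<alpha> (m $ \<nu>) * caputo_monomial \<alpha> \<mu> (lower_exponent \<nu> m) x"
  unfolding caputo_monomial_eq[of \<alpha> \<nu> m, abs_def]
  by (simp add: caputo_linear(2) frac_poly_monomial caputo_on_monomial[OF pos, folded U_def])

text \<open>
  For \<open>\<mu> \<noteq> \<nu>\<close> both orders lower the same two exponents, and lowering one exponent leaves the factor
  belonging to the other unchanged.
\<close>

lemma caputo_commute:
  assumes "f \<in> frac_poly \<alpha> U"
  shows "caputo \<alpha> U \<mu> (caputo \<alpha> U \<nu> f) x = caputo \<alpha> U \<nu> (caputo \<alpha> U \<mu> f) x"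
proof (cases "\<mu> = \<nu>")
  case False
  obtain p where p: "\<And>\<mu>. caputo \<alpha> U \<mu> f =
      (\<lambda>x. \<Sum>m\<in>Poly_Mapping.keys p. Poly_Mapping.lookup p m * caputo_monomial \<alpha> \<mu> m x)"
    using caputo_expansion[OF assms] by blast
  have twice: "caputo \<alpha> U \<kappa> (caputo \<alpha> U \<iota> f) x =
      (\<Sum>m\<in>Poly_Mapping.keys p. Poly_Mapping.lookup p m *
        (caputo_factor \<alpha> (m $ \<iota>) * caputo_monomial \<alpha> \<kappa> (lower_exponent \<iota> m) x))" for \<kappa> \<iota>
    unfolding p[of \<iota>]
    by (simp add: caputo_sum caputo_linear(2) frac_poly_scale frac_poly_caputo_monomial
        caputo_caputo_monomial)
  have "lower_exponent \<mu> (lower_exponent \<nu> m) = lower_exponent \<nu> (lower_exponent \<mu> m)" for m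
    by (simp add: lower_exponent_def vec_eq_iff)
  moreover have "lower_exponent \<nu> m $ \<mu> = m $ \<mu>" "lower_exponent \<mu> m $ \<nu> = m $ \<nu>" for m
    using False by (auto simp: lower_exponent_def)
  ultimately show ?thesis
    unfolding twice caputo_monomial_eq by (simp add: mult_ac)
qed simp

end


section \<open>From a first-order system to the wave equation\<close>

definition frac_div ::
    "real \<Rightarrow> (real ^ 4) set \<Rightarrow> (real ^ 4 \<Rightarrow> real ^ 3) \<Rightarrow> real ^ 4 \<Rightarrow> real" where
  "frac_div \<alpha> U V x =
     caputo \<alpha> U 1 (\<lambda>y. V y $ 1) x + caputo \<alpha> U 2 (\<lambda>y. V y $ 2) x + caputo \<alpha> U 3 (\<lambda>y. V y $ 3) x"

context
  fixes \<alpha> T b1 b2 b3 :: real and U :: "(real ^ 4) set"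
  assumes pos: "0 < \<alpha>" "0 < T" "0 < b1" "0 < b2" "0 < b3"
  defines "U \<equiv> spacetime_box T b1 b2 b3"
begin

lemmas caputo_rules =
  caputo_linear[OF pos, folded U_def] caputo_diff[OF pos, folded U_def]
  caputo_minus[OF pos, folded U_def] caputo_zero[OF pos, folded U_def]
lemmas frac_poly_rules =
  frac_poly_add frac_poly_diff frac_poly_minus frac_poly_caputo[OF pos, folded U_def]

lemma caputo_field_minus:
  assumes "V \<in> frac_poly_field \<alpha> U"
  shows "caputo_field \<alpha> U \<mu> (\<lambda>y. - V y) x = - caputo_field \<alpha> U \<mu> V x"
  using assms by (simp add: frac_poly_field_def caputo_field_def vec_eq_iff caputo_rules)

lemma frac_curl_minus:
  assumes "V \<in> frac_poly_field \<alpha> U"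
  shows "frac_curl \<alpha> U (\<lambda>y. - V y) x = - frac_curl \<alpha> U V x"
  using assms
  by (simp add: frac_poly_field_def frac_curl_def vec_eq_iff forall_3 vector_3 caputo_rules)

lemma frac_curl_zero: "frac_curl \<alpha> U (\<lambda>y. 0) x = 0"
  by (simp add: frac_curl_def vec_eq_iff forall_3 vector_3 caputo_rules)

lemma caputo_field_zero: "caputo_field \<alpha> U \<mu> (\<lambda>y. 0) x = 0"
  by (simp add: caputo_field_def vec_eq_iff caputo_rules)

lemma frac_grad_zero: "frac_grad \<alpha> U (\<lambda>y. 0) x = 0"
  by (simp add: frac_grad_def vec_eq_iff forall_3 vector_3 caputo_rules)

text \<open>
  Component \<open>a\<close> of the classical argument:
  \<open>\<partial>\<^sub>t \<partial>\<^sub>t X = - curl (\<partial>\<^sub>t Y) - \<partial>\<^sub>t M = - curl (curl X) + curl N - \<partial>\<^sub>t M\<close>, together with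
  \<open>curl (curl X) = grad (div X) - \<Delta> X\<close>, which holds as the operators commute.  The indices
  \<open>a\<close>, \<open>b\<close>, \<open>c\<close> stand for the cyclic permutations of \<open>1\<close>, \<open>2\<close>, \<open>3\<close>.
\<close>

lemma wave_equation_component:
  fixes a b c :: 4
  assumes poly: "Xa \<in> frac_poly \<alpha> U" "Xb \<in> frac_poly \<alpha> U" "Xc \<in> frac_poly \<alpha> U"
      "Yb \<in> frac_poly \<alpha> U" "Yc \<in> frac_poly \<alpha> U" "Ma \<in> frac_poly \<alpha> U"
      "Nb \<in> frac_poly \<alpha> U" "Nc \<in> frac_poly \<alpha> U"
    and Xa: "\<And>y. y \<in> U \<Longrightarrow> caputo \<alpha> U 0 Xa y = - (caputo \<alpha> U b Yc y - caputo \<alpha> U c Yb y) - Ma y"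
    and Yc: "\<And>y. y \<in> U \<Longrightarrow> caputo \<alpha> U 0 Yc y = caputo \<alpha> U a Xb y - caputo \<alpha> U b Xa y - Nc y"
    and Yb: "\<And>y. y \<in> U \<Longrightarrow> caputo \<alpha> U 0 Yb y = caputo \<alpha> U c Xa y - caputo \<alpha> U a Xc y - Nb y"
    and div: "\<And>y. y \<in> U \<Longrightarrow> caputo \<alpha> U a Xa y + caputo \<alpha> U b Xb y + caputo \<alpha> U c Xc y = \<sigma> y"
  shows "caputo \<alpha> U 0 (caputo \<alpha> U 0 Xa) x -
      (caputo \<alpha> U a (caputo \<alpha> U a Xa) x + caputo \<alpha> U b (caputo \<alpha> U b Xa) x +
       caputo \<alpha> U c (caputo \<alpha> U c Xa) x) =
    (caputo \<alpha> U b Nc x - caputo \<alpha> U c Nb x) - caputo \<alpha> U 0 Ma x - caputo \<alpha> U a \<sigma> x"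
proof -
  note comm = caputo_commute[OF pos, folded U_def]
  have "caputo \<alpha> U 0 (caputo \<alpha> U 0 Xa) x =
      - (caputo \<alpha> U b (caputo \<alpha> U 0 Yc) x - caputo \<alpha> U c (caputo \<alpha> U 0 Yb) x) - caputo \<alpha> U 0 Ma x"
    using poly
    by (simp add: caputo_cong[OF Xa] caputo_rules frac_poly_rules comm[of _ b 0] comm[of _ c 0])
  moreover have "caputo \<alpha> U b (caputo \<alpha> U 0 Yc) x =
      caputo \<alpha> U a (caputo \<alpha> U b Xb) x - caputo \<alpha> U b (caputo \<alpha> U b Xa) x - caputo \<alpha> U b Nc x"
    using poly by (simp add: caputo_cong[OF Yc] caputo_rules frac_poly_rules comm[of _ a b])
  moreover have "caputo \<alpha> U c (caputo \<alpha> U 0 Yb) x =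
      caputo \<alpha> U c (caputo \<alpha> U c Xa) x - caputo \<alpha> U a (caputo \<alpha> U c Xc) x - caputo \<alpha> U c Nb x"
    using poly by (simp add: caputo_cong[OF Yb] caputo_rules frac_poly_rules comm[of _ a c])
  moreover have "caputo \<alpha> U a \<sigma> x =
      caputo \<alpha> U a (caputo \<alpha> U a Xa) x + caputo \<alpha> U a (caputo \<alpha> U b Xb) x +
      caputo \<alpha> U a (caputo \<alpha> U c Xc) x"
    using poly by (simp add: caputo_cong[OF div, symmetric] caputo_rules frac_poly_rules)
  ultimately show ?thesis
    by simp
qed

text \<open>
  With two sources the evolution equations keep their form under
  \<open>(X, Y, M, N) \<mapsto> (Y, - X, N, - M)\<close>, so that one statement covers the magnetic and the electric
  field.
\<close>

lemma wave_equation_of_first_order_system: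
  assumes "X \<in> frac_poly_field \<alpha> U" "Y \<in> frac_poly_field \<alpha> U"
      "M \<in> frac_poly_field \<alpha> U" "N \<in> frac_poly_field \<alpha> U"
    and X: "\<And>y. y \<in> U \<Longrightarrow> caputo_field \<alpha> U 0 X y = - frac_curl \<alpha> U Y y - M y"
    and Y: "\<And>y. y \<in> U \<Longrightarrow> caputo_field \<alpha> U 0 Y y = frac_curl \<alpha> U X y - N y"
    and div: "\<And>y. y \<in> U \<Longrightarrow> frac_div \<alpha> U X y = \<sigma> y"
  shows "frac_box \<alpha> U X x = frac_curl \<alpha> U N x - caputo_field \<alpha> U 0 M x - frac_grad \<alpha> U \<sigma> x"
proof -
  note fields = assms(1-4)[unfolded frac_poly_field_def mem_Collect_eq, rule_format]
  note eqs = X Y div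
  note comps = eqs[unfolded caputo_field_def frac_curl_def frac_div_def vec_eq_iff forall_3,
    simplified vector_3 vec_lambda_beta vector_minus_component vector_uminus_component]
  note ops = frac_box_def frac_laplace_def frac_curl_def frac_grad_def caputo_field_def vector_3
  have "frac_box \<alpha> U X x $ 1 =
      (frac_curl \<alpha> U N x - caputo_field \<alpha> U 0 M x - frac_grad \<alpha> U \<sigma> x) $ 1"
    using wave_equation_component[OF fields(1)[of 1] fields(1)[of 2] fields(1)[of 3]
        fields(2)[of 2] fields(2)[of 3] fields(3)[of 1] fields(4)[of 2] fields(4)[of 3],
        where a = 1 and b = 2 and c = 3 and \<sigma> = \<sigma> and x = x] comps
    by (simp add: ops add_ac)
  moreover have "frac_box \<alpha> U X x $ 2 =
      (frac_curl \<alpha> U N x - caputo_field \<alpha> U 0 M x - frac_grad \<alpha> U \<sigma> x) $ 2"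
    using wave_equation_component[OF fields(1)[of 2] fields(1)[of 3] fields(1)[of 1]
        fields(2)[of 3] fields(2)[of 1] fields(3)[of 2] fields(4)[of 3] fields(4)[of 1],
        where a = 2 and b = 3 and c = 1 and \<sigma> = \<sigma> and x = x] comps
    by (simp add: ops add_ac)
  moreover have "frac_box \<alpha> U X x $ 3 =
      (frac_curl \<alpha> U N x - caputo_field \<alpha> U 0 M x - frac_grad \<alpha> U \<sigma> x) $ 3"
    using wave_equation_component[OF fields(1)[of 3] fields(1)[of 1] fields(1)[of 2]
        fields(2)[of 1] fields(2)[of 2] fields(3)[of 3] fields(4)[of 1] fields(4)[of 2],
        where a = 3 and b = 1 and c = 2 and \<sigma> = \<sigma> and x = x] comps
    by (simp add: ops add_ac)
  ultimately show ?thesis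
    by (simp add: vec_eq_iff forall_3)
qed

end


section \<open>The Maxwell system in vector form\<close>

lemmas neq_4 = less_4[THEN less_imp_neq] less_4[THEN less_imp_neq, symmetric]

lemma gen_wedge_gt: "\<mu> < \<nu> \<Longrightarrow> gen \<nu> \<and>\<^sub>e gen \<mu> = - (gen \<mu> \<and>\<^sub>e gen \<nu>)"
  by (rule gen_wedge_anticommute)

lemma gen_wedge_gt_left: "\<mu> < \<nu> \<Longrightarrow> gen \<nu> \<and>\<^sub>e (gen \<mu> \<and>\<^sub>e w) = - (gen \<mu> \<and>\<^sub>e (gen \<nu> \<and>\<^sub>e w))"
  using wedge_scale_left[of "- 1"]
  by (simp add: gen_wedge_gt flip: wedge_assoc)

lemma gen_wedge_self_left: "gen \<mu> \<and>\<^sub>e (gen \<mu> \<and>\<^sub>e w) = 0"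
  using wedge_scale_left[of 0] by (simp add: gen_wedge_self flip: wedge_assoc)

lemma wedge_minus_right: "u \<and>\<^sub>e (- v) = - (u \<and>\<^sub>e v)"
  using wedge_scale_right[of u "- 1" v] by simp

lemma wedge_zero_right: "u \<and>\<^sub>e 0 = 0"
  using wedge_scale_right[of u 0] by simp

text \<open>
  These rules sort a product of generators into increasing order, so that rewriting with them
  evaluates products of explicitly given generators.
\<close>

lemmas gen_sort = wedge_assoc gen_wedge_gt gen_wedge_gt_left gen_wedge_self gen_wedge_self_left
  wedge_minus_right wedge_zero_right less_4

lemma gen_wedge3_less:
  assumes "\<mu> < \<nu>" "\<nu> < \<kappa>"
  shows "gen \<mu> \<and>\<^sub>e (gen \<nu> \<and>\<^sub>e gen \<kappa>) = axis {\<mu>, \<nu>, \<kappa>} 1"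
proof -
  have "{(i, j). i \<in> {\<mu>} \<and> j \<in> {\<nu>, \<kappa>} \<and> j < i} = {}" "{\<mu>} \<inter> {\<nu>, \<kappa>} = {}"
    using assms by auto
  thus ?thesis
    using assms unfolding gen_wedge_less[OF assms(2)] unfolding gen_def wedge_axis
    by (simp add: wedge_sign_def insert_commute del: Collect_empty_eq)
qed

lemma gen_wedge2_nth: "\<mu> < \<nu> \<Longrightarrow> (gen \<mu> \<and>\<^sub>e gen \<nu>) $ I = (if I = {\<mu>, \<nu>} then 1 else 0)"
  by (auto simp: gen_wedge_less axis_def)

lemma pairs_4_distinct:
  "distinct [{0, 1}, {0, 2}, {0, 3}, {2, 3}, {1, 3}, {1, 2 :: 4}]"
  by (simp add: doubleton_eq_iff neq_4)

lemma triples_4_distinct: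
  "distinct [{1, 2, 3}, {0, 2, 3}, {0, 1, 3}, {0, 1, 2 :: 4}]"
proof -
  have "(0::4) \<in> {0, 2, 3} \<and> (0::4) \<notin> {1, 2, 3}" "(0::4) \<in> {0, 1, 3} \<and> (0::4) \<notin> {1, 2, 3}"
    "(0::4) \<in> {0, 1, 2} \<and> (0::4) \<notin> {1, 2, 3}" "(2::4) \<in> {0, 2, 3} \<and> (2::4) \<notin> {0, 1, 3}"
    "(3::4) \<in> {0, 2, 3} \<and> (3::4) \<notin> {0, 1, 2}" "(3::4) \<in> {0, 1, 3} \<and> (3::4) \<notin> {0, 1, 2}"
    by (simp_all add: neq_4)
  thus ?thesis
    unfolding distinct.simps list.set by blast
qed

lemma current_nth:
  "current \<rho> J x $ {1, 2, 3} = \<rho> x" "current \<rho> J x $ {0, 2, 3} = - J x $ 1"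
  "current \<rho> J x $ {0, 1, 3} = J x $ 2" "current \<rho> J x $ {0, 1, 2} = - J x $ 3"
proof -
  have neq: "{1, 2, 3} \<noteq> {0, 2, 3 :: 4}" "{1, 2, 3} \<noteq> {0, 1, 3 :: 4}" "{1, 2, 3} \<noteq> {0, 1, 2 :: 4}"
    "{0, 2, 3} \<noteq> {0, 1, 3 :: 4}" "{0, 2, 3} \<noteq> {0, 1, 2 :: 4}" "{0, 1, 3} \<noteq> {0, 1, 2 :: 4}"
    using triples_4_distinct unfolding distinct.simps list.set by blast+
  have current: "current \<rho> J x $ I =
      \<rho> x * (if I = {1, 2, 3} then 1 else 0) - J x $ 1 * (if I = {0, 2, 3} then 1 else 0) +
      J x $ 2 * (if I = {0, 1, 3} then 1 else 0) - J x $ 3 * (if I = {0, 1, 2} then 1 else 0)" for I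
    by (simp only: current_def wedge_assoc gen_wedge3_less less_4 axis_def vec_lambda_beta
        vector_add_component vector_minus_component vector_scaleR_component real_scaleR_def)
  show "current \<rho> J x $ {1, 2, 3} = \<rho> x" "current \<rho> J x $ {0, 2, 3} = - J x $ 1"
    "current \<rho> J x $ {0, 1, 3} = J x $ 2" "current \<rho> J x $ {0, 1, 2} = - J x $ 3"
    unfolding current by (simp_all only: neq neq[symmetric] if_True if_False) simp_all
qed

lemma current_eq_iff:
  "current \<rho> J x = current \<rho>' J' x \<longleftrightarrow> \<rho> x = \<rho>' x \<and> J x = J' x"
proof
  assume eq: "current \<rho> J x = current \<rho>' J' x"
  have "J x $ 1 = J' x $ 1" "J x $ 2 = J' x $ 2" "J x $ 3 = J' x $ 3" "\<rho> x = \<rho>' x"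
    using current_nth[of \<rho> J x] current_nth[of \<rho>' J' x] unfolding eq by simp_all
  thus "\<rho> x = \<rho>' x \<and> J x = J' x"
    by (simp add: vec_eq_iff forall_3)
qed (simp add: current_def)

lemma current_eq_0_iff: "current \<rho> J x = 0 \<longleftrightarrow> \<rho> x = 0 \<and> J x = 0"
  using current_eq_iff[of \<rho> J x "\<lambda>_. 0" "\<lambda>_. 0"] by (simp add: current_def)

lemma faraday_nth:
  "faraday E B x $ {0, 1} = - E x $ 1" "faraday E B x $ {0, 2} = - E x $ 2"
  "faraday E B x $ {0, 3} = - E x $ 3" "faraday E B x $ {2, 3} = B x $ 1"
  "faraday E B x $ {1, 3} = - B x $ 2" "faraday E B x $ {1, 2} = B x $ 3"
  by (simp_all add: faraday_def gen_wedge2_nth less_4 doubleton_eq_iff neq_4)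

lemma faraday_nth_eq_0:
  "I \<notin> {{0, 1}, {0, 2}, {0, 3}, {2, 3}, {1, 3}, {1, 2}} \<Longrightarrow> faraday E B x $ I = 0"
  by (simp add: faraday_def gen_wedge2_nth less_4)

text \<open>
  With the present signs the Hodge-type operator is the duality rotation of the electromagnetic
  field.
\<close>

lemma hodge_faraday: "hodge (faraday E B x) = faraday (\<lambda>y. - B y) E x"
  unfolding hodge_def faraday_nth by (simp add: faraday_def)

context
  fixes \<alpha> T b1 b2 b3 :: real and U :: "(real ^ 4) set"
  assumes pos: "0 < \<alpha>" "0 < T" "0 < b1" "0 < b2" "0 < b3"
  defines "U \<equiv> spacetime_box T b1 b2 b3"
begin

text \<open>
  Writing the result as a current makes \<open>d F = 0\<close> and \<open>d (\<star> F) = \<J>\<close> comparisons of two currents,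
  which are settled by \<open>current_eq_0_iff\<close> and \<open>current_eq_iff\<close>.
\<close>

lemma frac_d_faraday:
  assumes "E \<in> frac_poly_field \<alpha> U" "B \<in> frac_poly_field \<alpha> U"
  shows "frac_d \<alpha> U (faraday E B) x =
    current (frac_div \<alpha> U B) (\<lambda>y. - (caputo_field \<alpha> U 0 B y + frac_curl \<alpha> U E y)) x"
proof -
  define S :: "4 set set" where "S = {{0, 1}, {0, 2}, {0, 3}, {2, 3}, {1, 3}, {1, 2}}"
  have fields: "(\<lambda>y. E y $ k) \<in> frac_poly \<alpha> U" "(\<lambda>y. B y $ k) \<in> frac_poly \<alpha> U" for k
    using assms by (simp_all add: frac_poly_field_def)
  \<comment> \<open>\<open>sum_4\<close> lists the index set as \<open>1, 2, 3, 4\<close>.\<close>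
  have four: "(4 :: 4) = 0"
    by simp
  have "frac_d \<alpha> U (faraday E B) x =
      (\<Sum>I\<in>S. \<Sum>\<mu>\<in>UNIV. caputo \<alpha> U \<mu> (\<lambda>y. faraday E B y $ I) x *\<^sub>R (gen \<mu> \<and>\<^sub>e axis I 1))"
    unfolding frac_d_def
  proof (rule sum.mono_neutral_right)
    show "\<forall>I\<in>UNIV - S.
      (\<Sum>\<mu>\<in>UNIV. caputo \<alpha> U \<mu> (\<lambda>y. faraday E B y $ I) x *\<^sub>R (gen \<mu> \<and>\<^sub>e axis I 1)) = 0"
      unfolding S_def by (simp add: faraday_nth_eq_0 caputo_zero[OF pos, folded U_def])
  qed simp_all
  also have "\<dots> = (\<Sum>I\<leftarrow>[{0, 1}, {0, 2}, {0, 3}, {2, 3}, {1, 3}, {1, 2}].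
      \<Sum>\<mu>\<in>UNIV. caputo \<alpha> U \<mu> (\<lambda>y. faraday E B y $ I) x *\<^sub>R (gen \<mu> \<and>\<^sub>e axis I 1))"
    unfolding sum_list_distinct_conv_sum_set[OF pairs_4_distinct] by (simp add: S_def)
  also have "\<dots> =
    current (frac_div \<alpha> U B) (\<lambda>y. - (caputo_field \<alpha> U 0 B y + frac_curl \<alpha> U E y)) x"
    by (simp add: faraday_nth caputo_minus[OF pos, folded U_def] fields sum_4 four
        gen_sort gen_wedge_less[symmetric] current_def frac_div_def frac_curl_def caputo_field_def
        vector_3 scaleR_left_distrib scaleR_left_diff_distrib algebra_simps)
  finally show ?thesis .
qed

lemma frac_maxwell_faraday_iff:
  assumes "E \<in> frac_poly_field \<alpha> U" "B \<in> frac_poly_field \<alpha> U"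
  shows "frac_maxwell \<alpha> U (faraday E B) (current \<rho> J) \<longleftrightarrow>
    (\<forall>x\<in>U. frac_div \<alpha> U B x = 0 \<and> caputo_field \<alpha> U 0 B x = - frac_curl \<alpha> U E x \<and>
           frac_div \<alpha> U E x = \<rho> x \<and> caputo_field \<alpha> U 0 E x = frac_curl \<alpha> U B x - J x)"
proof -
  have mB: "(\<lambda>y. - B y) \<in> frac_poly_field \<alpha> U"
    using assms by (simp add: frac_poly_field_def frac_poly_minus)
  have solve: "- (a + b) = 0 \<longleftrightarrow> a = - b" "- (a + - b) = c \<longleftrightarrow> a = b - c" for a b c :: "real ^ 3"
    by (auto simp: algebra_simps eq_neg_iff_add_eq_0 neg_eq_iff_add_eq_0)
  show ?thesis
    unfolding frac_maxwell_def hodge_faraday frac_d_faraday[OF assms] frac_d_faraday[OF mB assms(1)]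
      current_eq_0_iff current_eq_iff frac_curl_minus[OF pos, folded U_def, OF assms(2)] solve
    by blast
qed

end


section \<open>Wave equations for the fractional electromagnetic field\<close>

theorem theorem7p8:
  fixes \<alpha> T b1 b2 b3 :: real
    and E B J :: "real ^ 4 \<Rightarrow> real ^ 3" and \<rho> :: "real ^ 4 \<Rightarrow> real"
    and U :: "(real ^ 4) set"
  assumes "0 < \<alpha>" and "\<alpha> < 1"
    and "0 < T" and "0 < b1" and "0 < b2" and "0 < b3"
    and "U = spacetime_box T b1 b2 b3"
    and "E \<in> frac_poly_field \<alpha> U" and "B \<in> frac_poly_field \<alpha> U"
    and "\<rho> \<in> frac_poly \<alpha> U" and "J \<in> frac_poly_field \<alpha> U"
    and "frac_maxwell \<alpha> U (faraday E B) (current \<rho> J)"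
  shows "(\<forall>x\<in>U. frac_box \<alpha> U B x = frac_curl \<alpha> U J x) \<and>
         (\<forall>x\<in>U. frac_box \<alpha> U E x = - caputo_field \<alpha> U 0 J x - frac_grad \<alpha> U \<rho> x) \<and>
         ((\<forall>x\<in>U. \<rho> x = 0) \<and> (\<forall>x\<in>U. J x = 0) \<longrightarrow>
            (\<forall>x\<in>U. frac_box \<alpha> U E x = 0) \<and> (\<forall>x\<in>U. frac_box \<alpha> U B x = 0))"
proof -
  note pos = assms(1,3-6)
  note box = assms(7)[symmetric]
  have maxwell:
    "frac_div \<alpha> U B x = 0" "caputo_field \<alpha> U 0 B x = - frac_curl \<alpha> U E x"
    "frac_div \<alpha> U E x = \<rho> x" "caputo_field \<alpha> U 0 E x = frac_curl \<alpha> U B x - J x" if "x \<in> U" for x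
    using assms(12) that
    unfolding frac_maxwell_faraday_iff[OF pos, unfolded box, OF assms(8,9)] by auto
  have fields: "(\<lambda>y. - B y) \<in> frac_poly_field \<alpha> U" "(\<lambda>y. 0) \<in> frac_poly_field \<alpha> U"
    using assms(9) by (simp_all add: frac_poly_field_def frac_poly_minus frac_poly_zero)
  note zero = frac_curl_zero[OF pos, unfolded box] caputo_field_zero[OF pos, unfolded box]
    frac_grad_zero[OF pos, unfolded box]
  note minus_B = caputo_field_minus[OF pos, unfolded box, OF assms(9)]
    frac_curl_minus[OF pos, unfolded box, OF assms(9)]
  note wave = wave_equation_of_first_order_system[OF pos, unfolded box]
  have B: "frac_box \<alpha> U B x = frac_curl \<alpha> U J x" for x
    using wave[OF assms(9,8) fields(2) assms(11), where \<sigma> = "\<lambda>_. 0"] maxwell by (simp add: zero)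
  have E: "frac_box \<alpha> U E x = - caputo_field \<alpha> U 0 J x - frac_grad \<alpha> U \<rho> x" for x
    using wave[OF assms(8) fields(1) assms(11) fields(2), where \<sigma> = \<rho>] maxwell
    by (simp add: zero minus_B)
  \<comment> \<open>The sources vanish on the box only, but the operators see no other values.\<close>
  have "frac_box \<alpha> U E x = 0 \<and> frac_box \<alpha> U B x = 0"
    if "\<forall>x\<in>U. \<rho> x = 0" "\<forall>x\<in>U. J x = 0" for x
  proof -
    have *: "caputo \<alpha> U \<mu> \<rho> = caputo \<alpha> U \<mu> (\<lambda>_. 0)"
      "caputo \<alpha> U \<mu> (\<lambda>y. J y $ k) = caputo \<alpha> U \<mu> (\<lambda>y. (0 :: real ^ 3) $ k)" for \<mu> k
      using that by (auto intro!: caputo_cong)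
    have "frac_grad \<alpha> U \<rho> = frac_grad \<alpha> U (\<lambda>_. 0)" "frac_curl \<alpha> U J = frac_curl \<alpha> U (\<lambda>_. 0)"
      "caputo_field \<alpha> U 0 J = caputo_field \<alpha> U 0 (\<lambda>_. 0)"
      unfolding frac_grad_def frac_curl_def caputo_field_def fun_eq_iff * by simp_all
    thus ?thesis
      by (simp add: E B zero)
  qed
  with B E show ?thesis
    by blast
qed

end
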